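(* Let $(V,\omega)$ be a finite-dimensional real symplectic vector space, let $\xi$ be the induced contact structure on $\mathbb{P}V$, and let $\Sigma\subset(\mathbb{P}V,\xi)$ be a regular hypersurface. When it is a local diffeomorphism, the outer contact billiard map over $\Sigma$ is a contactomorphism. That is: if $U\subset\mathbb{P}V$ is open and $F:U\to\mathbb{P}V$ is a local diffeomorphism such that for every $Z\in U$ the points $Z$ and $F(Z)$ are in outer contact billiard correspondence over $\Sigma$, then $dF_Z(\xi_Z)=\xi_{F(Z)}$ for all $Z\in U$.
   Context: $\mathbb{P}V$ is the space of lines through the origin in $V$; for a subspace $W\subset V$, $W^\omega=\{\mathbf u\in V:\omega(\mathbf u,\mathbf w)=0\ \forall \mathbf w\in W\}$. The contact structure: for $q\in\mathbb{P}V$ with lift $\mathbf q\in q\setminus\{0\}$, the contact hyperplane is $\xi_q=q^\omega$, a hyperplane of $V$ containing $q$; regarded as a projective hyperplane through $q$ it defines a hyperplane in $T_q\mathbb{P}V$, also denoted $\xi_q$ (a tangent vector represented by a derivative $\dot{\mathbf Z}$ of a lifted curve $\mathbf Z(t)$ lies in $\xi_Z$ iff $\omega(\mathbf Z,\dot{\mathbf Z})=0$). The contact point of a hyperplane $\Pi\subset V$ is the point $\Pi^\omega\in\mathbb{P}V$. For a regular (smooth) hypersurface $\Sigma\subset\mathbb{P}V$ (the table) and $q\in\Sigma$, let $T_q\Sigma$ also denote the projective tangent hyperplane (a hyperplane of $V$), and put $q'=(T_q\Sigma)^\omega$. When $q'\neq q$, the characteristic line at $q$ is the projective line through $q$ and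 $q'$. Collinear points $C,D$ are harmonic conjugates with respect to distinct points $A,B$ if there are lifts with $\mathbf C=\mathbf A+\mathbf B$ and $\mathbf D=\mathbf A-\mathbf B$. Points $Z,Z'\in\mathbb{P}V$ are in outer contact billiard correspondence over $\Sigma$ if there is $q\in\Sigma$ (with $q'\ne q$) such that the line through $Z,Z'$ is the characteristic line at $q$ and $Z,Z'$ are harmonic conjugates with respect to $q,q'$. *)

theory Defs
  imports "HOL-Analysis.Analysis"
begin

section \<open>Symplectic linear algebra\<close>

text \<open>The vector space is a type of class \<open>euclidean_space\<close>, i.e. an arbitrary nonzero
  finite-dimensional real vector space; its inner product only provides the standard topology
  and differential calculus and plays no role in the notions below.\<close>

definition symplectic_form :: "('a::euclidean_space \<Rightarrow> 'a \<Rightarrow> real) \<Rightarrow> bool" where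
  "symplectic_form \<omega> \<longleftrightarrow>
     bilinear \<omega> \<and> (\<forall>v. \<omega> v v = 0) \<and> (\<forall>v. (\<forall>w. \<omega> v w = 0) \<longrightarrow> v = 0)"

definition symp_perp :: "('a::euclidean_space \<Rightarrow> 'a \<Rightarrow> real) \<Rightarrow> 'a set \<Rightarrow> 'a set" where
  "symp_perp \<omega> W = {u. \<forall>w\<in>W. \<omega> u w = 0}"


section \<open>Smooth maps between vector spaces\<close>

text \<open>Both notions are meant for open \<open>S\<close>.\<close>

primrec Ck_on :: "nat \<Rightarrow> ('a::euclidean_space \<Rightarrow> 'b::real_normed_vector) \<Rightarrow> 'a set \<Rightarrow> bool" where
  "Ck_on 0 f S \<longleftrightarrow> continuous_on S f"
| "Ck_on (Suc k) f S \<longleftrightarrow>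
     (\<forall>x\<in>S. f differentiable (at x)) \<and> (\<forall>v. Ck_on k (\<lambda>x. frechet_derivative f (at x) v) S)"

definition smooth_on :: "('a::euclidean_space \<Rightarrow> 'b::real_normed_vector) \<Rightarrow> 'a set \<Rightarrow> bool" where
  "smooth_on f S \<longleftrightarrow> (\<forall>k. Ck_on k f S)"


section \<open>Projective space as a smooth manifold\<close>

text \<open>Points are the one-dimensional subspaces. The topology is the quotient topology of
  \<open>v \<mapsto> span {v}\<close> on the nonzero vectors.\<close>

definition proj_space :: "'a::euclidean_space set set" where
  "proj_space = {L. subspace L \<and> dim L = 1}"

definition proj_topology :: "'a::euclidean_space set topology" where
  "proj_topology =
     topology (\<lambda>U. U \<subseteq> proj_space \<and> open {v. v \<noteq> 0 \<and> span {v} \<in> U})"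

lemma openin_proj_topology:
  "openin proj_topology U \<longleftrightarrow> U \<subseteq> proj_space \<and> open {v::'a::euclidean_space. v \<noteq> 0 \<and> span {v} \<in> U}"
proof -
  have "istopology (\<lambda>U::'a set set. U \<subseteq> proj_space \<and> open {v. v \<noteq> 0 \<and> span {v} \<in> U})"
    unfolding istopology_def
  proof (intro conjI allI impI)
    fix S T :: "'a set set"
    assume S: "S \<subseteq> proj_space \<and> open {v. v \<noteq> 0 \<and> span {v} \<in> S}"
      and T: "T \<subseteq> proj_space \<and> open {v. v \<noteq> 0 \<and> span {v} \<in> T}"
    show "S \<inter> T \<subseteq> proj_space" using S by blast
    have "{v. v \<noteq> 0 \<and> span {v} \<in> S \<inter> T}
        = {v. v \<noteq> 0 \<and> span {v} \<in> S} \<inter> {v. v \<noteq> 0 \<and> span {v} \<in> T}" by blast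
    then show "open {v. v \<noteq> 0 \<and> span {v} \<in> S \<inter> T}"
      using open_Int[OF conjunct2[OF S] conjunct2[OF T]] by (simp only:)
  next
    fix K :: "'a set set set"
    assume K: "\<forall>S\<in>K. S \<subseteq> proj_space \<and> open {v. v \<noteq> 0 \<and> span {v} \<in> S}"
    show "\<Union>K \<subseteq> proj_space" using K by blast
    have "{v. v \<noteq> 0 \<and> span {v} \<in> \<Union>K} = (\<Union>S\<in>K. {v. v \<noteq> 0 \<and> span {v} \<in> S})" by blast
    then show "open {v. v \<noteq> 0 \<and> span {v} \<in> \<Union>K}" using K by auto
  qed
  then show ?thesis unfolding proj_topology_def by (simp add: topology_inverse')
qed

text \<open>The smooth structure is the one for which \<open>v \<mapsto> span {v}\<close> is a smooth submersion of the
  nonzero vectors: a function on projective space is smooth iff its composition with this map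
  is, and a map into projective space is smooth iff it has smooth lifts locally.\<close>

definition proj_smooth_fun :: "'a::euclidean_space set set \<Rightarrow> ('a set \<Rightarrow> real) \<Rightarrow> bool" where
  "proj_smooth_fun N h \<longleftrightarrow> smooth_on (\<lambda>v. h (span {v})) {v. v \<noteq> 0 \<and> span {v} \<in> N}"

definition is_lift :: "('a::euclidean_space set \<Rightarrow> 'a set) \<Rightarrow> 'a set \<Rightarrow> ('a \<Rightarrow> 'a) \<Rightarrow> bool" where
  "is_lift F W f \<longleftrightarrow> open W \<and> 0 \<notin> W \<and> smooth_on f W \<and>
     (\<forall>w\<in>W. f w \<noteq> 0 \<and> F (span {w}) = span {f w})"

definition proj_smooth_on :: "'a::euclidean_space set set \<Rightarrow> ('a set \<Rightarrow> 'a set) \<Rightarrow> bool" where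
  "proj_smooth_on U F \<longleftrightarrow>
     (\<forall>z. z \<noteq> 0 \<and> span {z} \<in> U \<longrightarrow> (\<exists>W f. z \<in> W \<and> is_lift F W f))"

definition proj_diffeo ::
    "'a::euclidean_space set set \<Rightarrow> 'a set set \<Rightarrow> ('a set \<Rightarrow> 'a set) \<Rightarrow> bool" where
  "proj_diffeo N M F \<longleftrightarrow> openin proj_topology N \<and> openin proj_topology M \<and>
     bij_betw F N M \<and> proj_smooth_on N F \<and> proj_smooth_on M (inv_into N F)"

definition proj_local_diffeo :: "'a::euclidean_space set set \<Rightarrow> ('a set \<Rightarrow> 'a set) \<Rightarrow> bool" where
  "proj_local_diffeo U F \<longleftrightarrow> (\<forall>Z\<in>U. \<exists>N M. Z \<in> N \<and> N \<subseteq> U \<and> proj_diffeo N M F)"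

text \<open>\<open>tangent_vec z v\<close> is the tangent vector at the point \<open>span {z}\<close> represented by the
  derivative \<open>v\<close> at \<open>0\<close> of a lifted curve that passes through \<open>z\<close> at time \<open>0\<close>. It is encoded as
  the class of all pairs (value, derivative) of lifts of the same curve: replacing
  \<open>Z(t)\<close> by \<open>g(t) Z(t)\<close> turns \<open>(z, v)\<close> into \<open>(g(0) z, g(0) v + g'(0) z)\<close>.\<close>

definition tangent_vec :: "'a::euclidean_space \<Rightarrow> 'a \<Rightarrow> ('a \<times> 'a) set" where
  "tangent_vec z v = {(c *\<^sub>R z, c *\<^sub>R v + d *\<^sub>R z) | c d. c \<noteq> 0}"

text \<open>The differential of \<open>F\<close> at \<open>Z\<close>, computed in any local lift of \<open>F\<close>; see \<open>proj_deriv_eq\<close>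
  below for independence of the choices.\<close>

definition proj_deriv ::
    "('a::euclidean_space set \<Rightarrow> 'a set) \<Rightarrow> 'a set \<Rightarrow> ('a \<times> 'a) set \<Rightarrow> ('a \<times> 'a) set" where
  "proj_deriv F Z X =
     (THE Y. \<exists>z v W f. z \<in> Z - {0} \<and> X = tangent_vec z v \<and> z \<in> W \<and> is_lift F W f \<and>
        Y = tangent_vec (f z) (frechet_derivative f (at z) v))"


section \<open>The contact structure\<close>

definition contact_plane :: "('a::euclidean_space \<Rightarrow> 'a \<Rightarrow> real) \<Rightarrow> 'a set \<Rightarrow> ('a \<times> 'a) set set" where
  "contact_plane \<omega> Z = {tangent_vec z v | z v. z \<in> Z - {0} \<and> v \<in> symp_perp \<omega> Z}"


section \<open>Hypersurfaces and the outer contact billiard correspondence\<close>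

definition defining_fun ::
    "'a::euclidean_space set set \<Rightarrow> 'a set \<Rightarrow> 'a set set \<Rightarrow> ('a set \<Rightarrow> real) \<Rightarrow> bool" where
  "defining_fun S q N h \<longleftrightarrow>
     openin proj_topology N \<and> q \<in> N \<and> proj_smooth_fun N h \<and> S \<inter> N = {p\<in>N. h p = 0} \<and>
     (\<forall>z\<in>q - {0}. frechet_derivative (\<lambda>v. h (span {v})) (at z) \<noteq> (\<lambda>v. 0))"

definition proj_hypersurface :: "'a::euclidean_space set set \<Rightarrow> bool" where
  "proj_hypersurface S \<longleftrightarrow> S \<subseteq> proj_space \<and> (\<forall>q\<in>S. \<exists>N h. defining_fun S q N h)"

text \<open>The projective tangent hyperplane, as a linear hyperplane: the kernel of the differential
  of a local defining function. All local defining functions at \<open>q\<close> and all lifts \<open>z\<close> of \<open>q\<close>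
  give the same kernel; the definition intersects over them to avoid a choice.\<close>

definition tangent_hyperplane :: "'a::euclidean_space set set \<Rightarrow> 'a set \<Rightarrow> 'a set" where
  "tangent_hyperplane S q =
     {v. \<forall>N h z. defining_fun S q N h \<and> z \<in> q - {0} \<longrightarrow>
           frechet_derivative (\<lambda>v. h (span {v})) (at z) v = 0}"

definition proj_line :: "'a::euclidean_space set \<Rightarrow> 'a set \<Rightarrow> 'a set" where
  "proj_line P Q = span (P \<union> Q)"

definition harmonic_conjugates ::
    "'a::euclidean_space set \<Rightarrow> 'a set \<Rightarrow> 'a set \<Rightarrow> 'a set \<Rightarrow> bool" where
  "harmonic_conjugates A B C D \<longleftrightarrow> A \<noteq> B \<and>
     (\<exists>a b. a \<noteq> 0 \<and> b \<noteq> 0 \<and> A = span {a} \<and> B = span {b} \<and>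
            C = span {a + b} \<and> D = span {a - b})"

definition outer_contact_billiard ::
    "('a::euclidean_space \<Rightarrow> 'a \<Rightarrow> real) \<Rightarrow> 'a set set \<Rightarrow> 'a set \<Rightarrow> 'a set \<Rightarrow> bool" where
  "outer_contact_billiard \<omega> S Z Z' \<longleftrightarrow>
     (\<exists>q\<in>S. let q' = symp_perp \<omega> (tangent_hyperplane S q) in
        q' \<noteq> q \<and> proj_line Z Z' = proj_line q q' \<and> harmonic_conjugates q q' Z Z')"


section \<open>Well-definedness of the differential\<close>

lemma tangent_vec_eqI:
  fixes z v :: "'a::euclidean_space"
  assumes "c \<noteq> 0" "z2 = c *\<^sub>R z" "v2 = c *\<^sub>R v + d *\<^sub>R z"
  shows "tangent_vec z2 v2 = tangent_vec z v"
proof (intro set_eqI iffI)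
  fix p assume "p \<in> tangent_vec z2 v2"
  then obtain a b where ab: "a \<noteq> 0" "p = (a *\<^sub>R z2, a *\<^sub>R v2 + b *\<^sub>R z2)"
    unfolding tangent_vec_def by blast
  then have "p = ((a*c) *\<^sub>R z, (a*c) *\<^sub>R v + (a*d + b*c) *\<^sub>R z)"
    using assms by (simp add: algebra_simps)
  moreover have "a * c \<noteq> 0" using ab assms by simp
  ultimately show "p \<in> tangent_vec z v" unfolding tangent_vec_def by blast
next
  fix p assume "p \<in> tangent_vec z v"
  then obtain a b where ab: "a \<noteq> 0" "p = (a *\<^sub>R z, a *\<^sub>R v + b *\<^sub>R z)"
    unfolding tangent_vec_def by blast
  define b' where "b' = (b - a*d/c)/c"
  have eq: "a / c * d + b' * c = b" using \<open>c \<noteq> 0\<close> by (simp add: b'_def field_simps)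
  have "(a/c) *\<^sub>R v2 + b' *\<^sub>R z2 = a *\<^sub>R v + (a / c * d + b' * c) *\<^sub>R z"
    using assms by (simp add: scaleR_add_right scaleR_add_left)
  then have "p = ((a/c) *\<^sub>R z2, (a/c) *\<^sub>R v2 + b' *\<^sub>R z2)"
    using ab assms eq by simp
  moreover have "a / c \<noteq> 0" using ab assms by simp
  ultimately show "p \<in> tangent_vec z2 v2" unfolding tangent_vec_def by blast
qed

lemma tangent_vec_eqD:
  assumes "tangent_vec z2 v2 = tangent_vec z v"
  obtains c d where "c \<noteq> 0" "z2 = c *\<^sub>R z" "v2 = c *\<^sub>R v + d *\<^sub>R z"
proof -
  have "(1 *\<^sub>R z2, 1 *\<^sub>R v2 + 0 *\<^sub>R z2) \<in> tangent_vec z2 v2"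
    unfolding tangent_vec_def by (metis (mono_tags, lifting) mem_Collect_eq one_neq_zero)
  then have "(z2, v2) \<in> tangent_vec z v" using assms by simp
  then show ?thesis using that unfolding tangent_vec_def by blast
qed

lemma span_sing_scale:
  fixes z :: "'a::real_vector"
  assumes "c \<noteq> 0" shows "span {c *\<^sub>R z} = span {z}"
  using span_image_scale[of "{z}" "\<lambda>_. c"] assms by simp

lemma is_lift_has_derivative:
  assumes "is_lift F W f" "z \<in> W"
  shows "(f has_derivative frechet_derivative f (at z)) (at z)"
proof -
  have "Ck_on (Suc 0) f W" using assms unfolding is_lift_def smooth_on_def by blast
  then show ?thesis using assms(2) frechet_derivative_works by auto
qed

lemma lift_derivative_radial:
  fixes f :: "'a::euclidean_space \<Rightarrow> 'a"
  assumes L: "is_lift F W f" and z: "z \<in> W"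
  shows "\<exists>m. frechet_derivative f (at z) z = m *\<^sub>R f z"
proof -
  define k where "k = f z"
  have k0: "k \<noteq> 0" using L z unfolding is_lift_def k_def by blast
  define P where "P = (\<lambda>x. x - ((x \<bullet> k) / (k \<bullet> k)) *\<^sub>R k)"
  have lin: "bounded_linear P"
  proof -
    have "linear P"
      unfolding P_def
      by (rule linearI) (simp_all add: inner_add_left add_divide_distrib scaleR_add_left scaleR_diff_right)
    then show ?thesis by (simp add: linear_conv_bounded_linear)
  qed
  have "((\<lambda>t. f ((1 + t) *\<^sub>R z)) has_derivative (\<lambda>t. frechet_derivative f (at z) (t *\<^sub>R z))) (at (0::real))"
  proof -
    have g: "((\<lambda>t::real. (1 + t) *\<^sub>R z) has_derivative (\<lambda>t. t *\<^sub>R z)) (at 0)"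
      by (auto intro!: derivative_eq_intros)
    have "(f has_derivative frechet_derivative f (at z)) (at ((1 + 0) *\<^sub>R z))"
      using is_lift_has_derivative[OF L z] by simp
    from has_derivative_compose[OF g this] show ?thesis by simp
  qed
  from bounded_linear.has_derivative[OF lin this]
  have d1: "((\<lambda>t. P (f ((1 + t) *\<^sub>R z))) has_derivative (\<lambda>t. P (frechet_derivative f (at z) (t *\<^sub>R z)))) (at (0::real))" .
  have "open W" using L unfolding is_lift_def by blast
  have cont: "isCont (\<lambda>t::real. (1 + t) *\<^sub>R z) 0" by (intro continuous_intros)
  have "\<forall>\<^sub>F t in at (0::real). (1 + t) *\<^sub>R z \<in> W"
    using cont \<open>open W\<close> z unfolding isCont_def by (auto dest!: topological_tendstoD)
  moreover have "\<forall>\<^sub>F t in at (0::real). t \<noteq> -1"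
    using eventually_at_in_open'[of "-{-1}" "0::real"] by (simp add: open_Compl)
  ultimately have ev: "\<forall>\<^sub>F t in at (0::real). P (f ((1 + t) *\<^sub>R z)) = 0"
  proof eventually_elim
    case (elim t)
    have "1 + t \<noteq> 0" using elim(2) by linarith
    note sp = span_sing_scale[OF this, of z]
    have "F (span {(1 + t) *\<^sub>R z}) = span {f ((1 + t) *\<^sub>R z)}" "F (span {z}) = span {k}"
      using L z elim(1) unfolding is_lift_def k_def by blast+
    then have "span {f ((1 + t) *\<^sub>R z)} = span {k}" using sp by (simp only:)
    then have "f ((1 + t) *\<^sub>R z) \<in> span {k}" using span_base by blast
    then obtain m where "f ((1 + t) *\<^sub>R z) = m *\<^sub>R k" by (auto simp: span_singleton)
    then show ?case using k0 unfolding P_def by simp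
  qed
  have "P (f ((1 + 0) *\<^sub>R z)) = 0" using k0 unfolding P_def k_def by simp
  then have "((\<lambda>t::real. 0) has_derivative (\<lambda>t. P (frechet_derivative f (at z) (t *\<^sub>R z)))) (at (0::real))"
    using has_derivative_transform_eventually[OF d1 ev] by simp
  then have "(\<lambda>t. P (frechet_derivative f (at z) (t *\<^sub>R z))) = (\<lambda>t. 0)"
    using has_derivative_unique has_derivative_const by blast
  then have "P (frechet_derivative f (at z) (1 *\<^sub>R z)) = 0" by meson
  then show ?thesis unfolding P_def k_def by auto
qed

lemma lift_derivative_unique:
  fixes f1 f2 :: "'a::euclidean_space \<Rightarrow> 'a"
  assumes L1: "is_lift F W1 f1" and z1: "z1 \<in> W1"
    and L2: "is_lift F W2 f2" and z2: "z2 \<in> W2"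
    and eq: "tangent_vec z2 v2 = tangent_vec z1 v1"
  shows "tangent_vec (f2 z2) (frechet_derivative f2 (at z2) v2)
       = tangent_vec (f1 z1) (frechet_derivative f1 (at z1) v1)"
proof -
  obtain c d where c: "c \<noteq> 0" "z2 = c *\<^sub>R z1" "v2 = c *\<^sub>R v1 + d *\<^sub>R z1"
    using tangent_vec_eqD[OF eq] .
  let ?D1 = "frechet_derivative f1 (at z1)" and ?D2 = "frechet_derivative f2 (at z2)"
  note D1 = is_lift_has_derivative[OF L1 z1] and D2 = is_lift_has_derivative[OF L2 z2]
  have f1z: "f1 z1 \<noteq> 0" using L1 z1 unfolding is_lift_def by blast
  have f2z: "f2 z2 \<noteq> 0" using L2 z2 unfolding is_lift_def by blast
  define lam where "lam = (\<lambda>w. (f2 (c *\<^sub>R w) \<bullet> f1 w) / (f1 w \<bullet> f1 w))"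
  have D2c: "((\<lambda>w. f2 (c *\<^sub>R w)) has_derivative (\<lambda>w. ?D2 (c *\<^sub>R w))) (at z1)"
  proof -
    have g: "((\<lambda>w. c *\<^sub>R w) has_derivative (\<lambda>w. c *\<^sub>R w)) (at z1)"
      by (auto intro!: derivative_eq_intros)
    show ?thesis using has_derivative_compose[OF g] D2 c(2) by simp
  qed
  have "lam differentiable (at z1)"
    unfolding lam_def
    by (intro differentiable_divide differentiable_inner)
       (use D1 D2c f1z in \<open>auto simp: differentiable_def\<close>)
  then obtain lam' where lam': "(lam has_derivative lam') (at z1)"
    unfolding differentiable_def by blast
  have rel: "f2 (c *\<^sub>R w) = lam w *\<^sub>R f1 w" if "w \<in> W1" "c *\<^sub>R w \<in> W2" for w
  proof -
    have n: "f1 w \<noteq> 0" using L1 that unfolding is_lift_def by blast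
    have "span {f2 (c *\<^sub>R w)} = F (span {c *\<^sub>R w})"
      using L2 that unfolding is_lift_def by auto
    also have "\<dots> = span {f1 w}"
      using L1 that span_sing_scale[OF c(1), of w] unfolding is_lift_def by auto
    finally have "f2 (c *\<^sub>R w) \<in> span {f1 w}" using span_base by blast
    then obtain m where "f2 (c *\<^sub>R w) = m *\<^sub>R f1 w" by (auto simp: span_singleton)
    then show ?thesis using n unfolding lam_def by simp
  qed
  have "open W1" "open W2" using L1 L2 unfolding is_lift_def by auto
  have "\<forall>\<^sub>F w in at z1. w \<in> W1"
    using \<open>open W1\<close> z1 by (rule eventually_at_in_open')
  moreover have "\<forall>\<^sub>F w in at z1. c *\<^sub>R w \<in> W2"
  proof -
    have "isCont (\<lambda>w. c *\<^sub>R w) z1" by (intro continuous_intros)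
    then show ?thesis using \<open>open W2\<close> z2 c(2) unfolding isCont_def by (auto dest!: topological_tendstoD)
  qed
  ultimately have ev: "\<forall>\<^sub>F w in at z1. f2 (c *\<^sub>R w) = lam w *\<^sub>R f1 w"
    by eventually_elim (rule rel)
  have at: "f2 (c *\<^sub>R z1) = lam z1 *\<^sub>R f1 z1" using rel z1 z2 c by simp
  have "((\<lambda>w. lam w *\<^sub>R f1 w) has_derivative (\<lambda>w. ?D2 (c *\<^sub>R w))) (at z1)"
    using has_derivative_transform_eventually[OF D2c ev at] by simp
  moreover have "((\<lambda>w. lam w *\<^sub>R f1 w) has_derivative (\<lambda>w. lam z1 *\<^sub>R ?D1 w + lam' w *\<^sub>R f1 z1)) (at z1)"
    using has_derivative_scaleR[OF lam' D1] .
  ultimately have "(\<lambda>w. ?D2 (c *\<^sub>R w)) = (\<lambda>w. lam z1 *\<^sub>R ?D1 w + lam' w *\<^sub>R f1 z1)"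
    by (rule has_derivative_unique)
  then have e1: "?D2 (c *\<^sub>R v1) = lam z1 *\<^sub>R ?D1 v1 + lam' v1 *\<^sub>R f1 z1" by meson
  obtain m where m: "?D2 z2 = m *\<^sub>R f2 z2" using lift_derivative_radial[OF L2 z2] by blast
  have lin: "linear ?D2" using D2 has_derivative_linear by blast
  have "d *\<^sub>R z1 = (d/c) *\<^sub>R z2" using c by simp
  then have "?D2 (d *\<^sub>R z1) = (d/c) *\<^sub>R ?D2 z2" using linear_cmul[OF lin, of "d/c" z2] by (simp only:)
  also have "\<dots> = (d/c) *\<^sub>R (m *\<^sub>R (lam z1 *\<^sub>R f1 z1))" using m at c(2) by (simp only:)
  finally have "?D2 (d *\<^sub>R z1) = (d * m * lam z1 / c) *\<^sub>R f1 z1" by simp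
  then have "?D2 v2 = lam z1 *\<^sub>R ?D1 v1 + (lam' v1 + d * m * lam z1 / c) *\<^sub>R f1 z1"
    using e1 c(3) linear_add[OF lin] by (simp add: scaleR_add_left)
  moreover have "f2 z2 = lam z1 *\<^sub>R f1 z1" using at c(2) by simp
  moreover have "lam z1 \<noteq> 0" using f2z calculation(2) by auto
  ultimately show ?thesis by (intro tangent_vec_eqI)
qed

theorem proj_deriv_eq:
  fixes f :: "'a::euclidean_space \<Rightarrow> 'a"
  assumes L: "is_lift F W f" and z: "z \<in> W" "z \<in> Z - {0}"
  shows "proj_deriv F Z (tangent_vec z v) = tangent_vec (f z) (frechet_derivative f (at z) v)"
  unfolding proj_deriv_def
proof (rule the_equality)
  show "\<exists>z' v' W f'. z' \<in> Z - {0} \<and> tangent_vec z v = tangent_vec z' v' \<and> z' \<in> W \<and> is_lift F W f' \<and>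
      tangent_vec (f z) (frechet_derivative f (at z) v)
      = tangent_vec (f' z') (frechet_derivative f' (at z') v')"
    using assms by (intro exI[of _ z] exI[of _ v] exI[of _ W] exI[of _ f]) simp
next
  fix Y
  assume "\<exists>z' v' W f'. z' \<in> Z - {0} \<and> tangent_vec z v = tangent_vec z' v' \<and> z' \<in> W \<and> is_lift F W f' \<and>
      Y = tangent_vec (f' z') (frechet_derivative f' (at z') v')"
  then obtain z' v' W' f' where *: "tangent_vec z v = tangent_vec z' v'" "z' \<in> W'" "is_lift F W' f'"
      "Y = tangent_vec (f' z') (frechet_derivative f' (at z') v')" by (elim exE conjE)
  show "Y = tangent_vec (f z) (frechet_derivative f (at z) v)"
    unfolding *(4) by (rule lift_derivative_unique[OF L z(1) *(3) *(2) *(1)[symmetric]])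
qed

end

theory Submission
  imports Defs
begin

text \<open>Let \<open>f\<close> be a local lift of the map and let \<open>w\<close> move along a line with direction \<open>v\<close>. The
  correspondence says that \<open>w + c f(w)\<close> lies over \<open>\<Sigma>\<close> and \<open>w - c f(w)\<close> over the contact point of
  the tangent hyperplane there, for some \<open>c = c(w)\<close>. Hence the
  differential of a defining function at \<open>w + c f(w)\<close> is a multiple of \<open>\<omega>(w - c f(w), \<cdot>)\<close>. It
  kills the radial vector \<open>w + c f(w)\<close>, which gives \<open>\<omega>(w, f(w)) = 0\<close>. So it kills \<open>f(w)\<close>, and the derivative in \<open>c\<close> vanishes, while the derivative in \<open>w\<close> along \<open>v\<close> is a
  multiple of \<open>\<alpha>(v) - c\<^sup>2 \<beta>(v)\<close> with \<open>\<alpha> = \<omega>(w, \<cdot>)\<close> and \<open>\<beta> = \<omega>(f(w), df(\<cdot>))\<close>.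

  If \<open>c\<close> were differentiable, \<open>\<alpha> = c\<^sup>2 \<beta>\<close> would follow at once. But \<open>c\<close> depends on a choice of the
  point of \<open>\<Sigma>\<close> and may be discontinuous. An argument in the style of Sard's theorem still shows
  that \<open>\<alpha>(v) = c\<^sup>2 \<beta>(v)\<close> at some points of every interval of the line, so that
  \<open>\<alpha>(v) \<beta>(v) \<ge> 0\<close> everywhere by continuity. Two nonzero linear forms whose product is nowhere
  negative have the same kernel, and equality of these kernels is the claim.\<close>

section \<open>Sard-type arguments on the real line\<close>

text \<open>This is Sard's theorem for a real function. The identification of \<open>real\<close>
  with \<open>real^1\<close> brings it under \<open>baby_Sard\<close>, where the zero derivative has
  a matrix of rank 0.\<close>

lemma negligible_image_derivative_zero:
  fixes f :: "real \<Rightarrow> real"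
  assumes "\<And>x. x \<in> S \<Longrightarrow> (f has_derivative (\<lambda>_. 0)) (at x within S)"
  shows "negligible (f ` S)"
proof -
  define g :: "real^1 \<Rightarrow> real^1" where "g = (\<lambda>x. vec (f (x $ 1)))"
  define S' :: "(real^1) set" where "S' = vec ` S"
  have pr: "((\<lambda>x::real^1. x $ 1) has_derivative (\<lambda>x. x $ 1)) (at x within T)" for x T
    by (simp add: bounded_linear_imp_has_derivative bounded_linear_vec_nth)
  have vl: "bounded_linear (vec :: real \<Rightarrow> real^1)"
    by (simp add: linear_conv_bounded_linear[symmetric] linear_vec)
  have im: "(\<lambda>x::real^1. x $ 1) ` S' = S" unfolding S'_def by (simp add: image_image)
  have der: "(g has_derivative (\<lambda>_. 0)) (at x within S')" if "x \<in> S'" for x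
  proof -
    have "x $ 1 \<in> S" using that im by blast
    then have "(f has_derivative (\<lambda>_. 0)) (at (x $ 1) within (\<lambda>x::real^1. x $ 1) ` S')"
      using assms im by simp
    then have "((\<lambda>x. f (x $ 1)) has_derivative (\<lambda>_. 0)) (at x within S')"
      using has_derivative_in_compose[OF pr] by blast
    from bounded_linear.has_derivative[OF vl this]
    show ?thesis unfolding g_def by (simp add: vec_0)
  qed
  have mat: "matrix (\<lambda>_::real^1. 0::real^1) = 0"
    by (simp add: matrix_def vec_eq_iff)
  have "negligible (g ` S')"
    by (rule baby_Sard[where f' = "\<lambda>_ _. 0"]) (use der mat in auto)
  moreover have "(\<lambda>x::real^1. x $ 1) differentiable_on g ` S'"
    unfolding differentiable_on_def differentiable_def using pr by blast
  ultimately have "negligible ((\<lambda>x::real^1. x $ 1) ` g ` S')"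
    by (rule negligible_differentiable_image_negligible[rotated]) simp
  moreover have "(\<lambda>x::real^1. x $ 1) ` g ` S' = f ` S"
    unfolding g_def S'_def by (simp add: image_image)
  ultimately show ?thesis by simp
qed

text \<open>By \<open>steep\<close> the graph of \<open>c\<close> has a vertical tangent at each of
  its points, where only nearby points of the graph count. The interval is a countable union of
  pieces on which \<open>c\<close> is injective and its inverse has derivative zero. Each piece is
  negligible by the Sard statement, but the interval is not.\<close>

lemma no_infinitely_steep_function:
  fixes a b :: real and c :: "real \<Rightarrow> real"
  assumes ab: "a < b"
    and steep: "\<And>t \<delta>. \<lbrakk>t \<in> {a<..<b}; \<delta> > 0\<rbrakk> \<Longrightarrow>
      \<exists>\<eta>>0. \<forall>s\<in>{a<..<b}. \<bar>s - t\<bar> < \<eta> \<and> \<bar>c s - c t\<bar> < \<eta> \<longrightarrow> \<bar>s - t\<bar> \<le> \<delta> * \<bar>c s - c t\<bar>"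
  shows False
proof -
  \<comment> \<open>On a piece, \<open>m\<close> fixes a radius within which the steepness estimate
    for \<delta> = 1 holds, while \<open>j\<close> and \<open>k\<close> fix grid cells of that width
    for \<open>t\<close> and \<open>c t\<close>. So any two points of a piece are within the radius
    in both coordinates, and the estimate holds for every pair.\<close>
  define B where "B = (\<lambda>(m::nat, j::int, k::int). {t\<in>{a<..<b}.
     (\<forall>s\<in>{a<..<b}. \<bar>s - t\<bar> < 1 / Suc m \<and> \<bar>c s - c t\<bar> < 1 / Suc m \<longrightarrow> \<bar>s - t\<bar> \<le> \<bar>c s - c t\<bar>) \<and>
     \<lfloor>t * real (Suc m)\<rfloor> = j \<and> \<lfloor>c t * real (Suc m)\<rfloor> = k})"
  have close: "\<bar>x - y\<bar> < 1 / Suc m" if "\<lfloor>x * Suc m\<rfloor> = \<lfloor>y * Suc m\<rfloor>" for x y :: real and m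
  proof -
    have "\<bar>x * Suc m - y * Suc m\<bar> < 1" using that by linarith
    then have "\<bar>x - y\<bar> * Suc m < 1"
      by (metis abs_mult abs_of_nat left_diff_distrib)
    then show ?thesis by (simp add: pos_less_divide_eq)
  qed
  have neg: "negligible (B i)" for i
  proof -
    obtain m j k where i: "i = (m, j, k)" by (cases i) auto
    have lip: "\<bar>s - t\<bar> \<le> \<bar>c s - c t\<bar>" if "s \<in> B i" "t \<in> B i" for s t
      using that close[of s m t] close[of "c s" m "c t"] unfolding i B_def by auto
    then have inj: "inj_on c (B i)" unfolding inj_on_def by fastforce
    define g where "g = inv_into (B i) c"
    have g: "g (c t) = t" if "t \<in> B i" for t
      unfolding g_def using inj that by (simp add: inv_into_f_f)
    \<comment> \<open>Steepness at \<open>t\<close> with \<delta> = \<open>e\<close> is the estimate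
      for derivative zero of \<open>g\<close> at \<open>c t\<close>. It asks that \<open>s\<close>
      be close to \<open>t\<close>, which follows from \<open>lip\<close> once \<open>c s\<close> is
      close to \<open>c t\<close>.\<close>
    have "(g has_derivative (\<lambda>_. 0)) (at x within c ` B i)" if "x \<in> c ` B i" for x
      unfolding has_derivative_within_alt
    proof (intro conjI allI impI)
      show "bounded_linear (\<lambda>_::real. 0::real)" by (rule bounded_linear_zero)
      fix e :: real assume "e > 0"
      obtain t where t: "t \<in> B i" "x = c t" using \<open>x \<in> c ` B i\<close> by blast
      have "t \<in> {a<..<b}" using t(1) unfolding i B_def by auto
      from steep[OF this \<open>e > 0\<close>] obtain \<eta> where \<eta>: "\<eta> > 0"
        "\<And>s. \<lbrakk>s \<in> {a<..<b}; \<bar>s - t\<bar> < \<eta>; \<bar>c s - c t\<bar> < \<eta>\<rbrakk> \<Longrightarrow> \<bar>s - t\<bar> \<le> e * \<bar>c s - c t\<bar>"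
        by blast
      have "norm (g y - g x - 0) \<le> e * norm (y - x)" if "y \<in> c ` B i" "norm (y - x) < \<eta>" for y
      proof -
        obtain s where s: "s \<in> B i" "y = c s" using \<open>y \<in> c ` B i\<close> by blast
        have "s \<in> {a<..<b}" using s(1) unfolding i B_def by auto
        with \<eta>(2)[of s] lip[OF s(1) t(1)] that(2) show ?thesis
          using g[OF s(1)] g[OF t(1)] s(2) t(2) by simp
      qed
      with \<eta>(1) show "\<exists>d>0. \<forall>y\<in>c ` B i. norm (y - x) < d \<longrightarrow> norm (g y - g x - 0) \<le> e * norm (y - x)"
        by blast
    qed
    then have "negligible (g ` c ` B i)" by (rule negligible_image_derivative_zero)
    moreover have "g ` c ` B i = B i" using g by (force simp: image_image)
    ultimately show ?thesis by simp
  qed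
  have "{a<..<b} \<subseteq> (\<Union>i. B i)"
  proof
    fix t assume t: "t \<in> {a<..<b}"
    obtain \<eta> where \<eta>: "\<eta> > 0"
      "\<And>s. \<lbrakk>s \<in> {a<..<b}; \<bar>s - t\<bar> < \<eta>; \<bar>c s - c t\<bar> < \<eta>\<rbrakk> \<Longrightarrow> \<bar>s - t\<bar> \<le> 1 * \<bar>c s - c t\<bar>"
      using steep[OF t zero_less_one] by blast
    obtain m where m: "1 / Suc m < \<eta>" using \<eta>(1) nat_approx_posE by blast
    have "t \<in> B (m, \<lfloor>t * real (Suc m)\<rfloor>, \<lfloor>c t * real (Suc m)\<rfloor>)"
      unfolding B_def using t \<eta>(2) m by fastforce
    then show "t \<in> (\<Union>i. B i)" by blast
  qed
  moreover have "negligible (\<Union>i. B i)"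
    by (rule negligible_countable_Union) (use neg in auto)
  ultimately have "negligible {a<..<b}" by (meson negligible_subset)
  moreover have "\<not> negligible {a<..<b}" using ab by (intro open_not_negligible) auto
  ultimately show False by blast
qed

text \<open>The differential of \<open>G\<close> sees only the first coordinate, so the zero set of
  \<open>G\<close> is vertical to first order at \<open>(t, c t)\<close>. The graph of
  \<open>c\<close> lies in it near that point, hence \<open>c\<close> is infinitely steep there. The
  function \<open>c\<close> may jump, since only graph points near \<open>(t, c t)\<close> are
  constrained.\<close>

lemma no_transversal_envelope:
  fixes a b :: real and c :: "real \<Rightarrow> real"
  assumes "a < b"
    and G: "\<And>t. t \<in> {a<..<b} \<Longrightarrow> \<exists>G \<kappa>. \<kappa> \<noteq> 0 \<and> G (t, c t) = 0 \<and>
      (G has_derivative (\<lambda>p. \<kappa> * fst p)) (at (t, c t)) \<and>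
      (\<forall>\<^sub>F p in nhds (t, c t). fst p \<in> {a<..<b} \<and> snd p = c (fst p) \<longrightarrow> G p = (0::real))"
  shows False
proof (rule no_infinitely_steep_function[OF \<open>a < b\<close>])
  fix t \<delta> :: real assume t: "t \<in> {a<..<b}" and "\<delta> > 0"
  obtain G \<kappa> where k0: "\<kappa> \<noteq> 0" and G0: "G (t, c t) = 0"
    and D: "(G has_derivative (\<lambda>p. \<kappa> * fst p)) (at (t, c t))"
    and ev: "\<forall>\<^sub>F p in nhds (t, c t). fst p \<in> {a<..<b} \<and> snd p = c (fst p) \<longrightarrow> G p = (0::real)"
    using G[OF t] by blast
  \<comment> \<open>The first-order estimate will read |\<kappa>| |s - t| \<le> \<epsilon> (|s - t|
    + |c s - c t|). With this \<epsilon>, solving for |s - t| gives exactly the factor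
    \<delta>.\<close>
  define \<epsilon> where "\<epsilon> = \<bar>\<kappa>\<bar> * \<delta> / (1 + \<delta>)"
  have "\<epsilon> > 0" using k0 \<open>\<delta> > 0\<close> unfolding \<epsilon>_def by simp
  obtain d1 where d1: "d1 > 0" "\<And>p. norm (p - (t, c t)) < d1 \<Longrightarrow>
      norm (G p - G (t, c t) - \<kappa> * fst (p - (t, c t))) \<le> \<epsilon> * norm (p - (t, c t))"
    using D \<open>\<epsilon> > 0\<close> unfolding has_derivative_at_alt by blast
  obtain d2 where d2: "d2 > 0" "\<And>p. dist p (t, c t) < d2 \<Longrightarrow>
      fst p \<in> {a<..<b} \<and> snd p = c (fst p) \<Longrightarrow> G p = 0"
    using ev unfolding eventually_nhds_metric by blast
  \<comment> \<open>The radius is halved because the norm is bounded by the sum of the two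
    coordinate differences.\<close>
  show "\<exists>\<eta>>0. \<forall>s\<in>{a<..<b}. \<bar>s - t\<bar> < \<eta> \<and> \<bar>c s - c t\<bar> < \<eta> \<longrightarrow> \<bar>s - t\<bar> \<le> \<delta> * \<bar>c s - c t\<bar>"
  proof (intro exI[of _ "min d1 d2 / 2"] conjI ballI impI)
    show "0 < min d1 d2 / 2" using d1(1) d2(1) by simp
    fix s assume s: "s \<in> {a<..<b}" and near: "\<bar>s - t\<bar> < min d1 d2 / 2 \<and> \<bar>c s - c t\<bar> < min d1 d2 / 2"
    define n where "n = norm ((s, c s) - (t, c t))"
    have n: "n \<le> \<bar>s - t\<bar> + \<bar>c s - c t\<bar>"
      unfolding n_def using norm_Pair_le[of "s - t" "c s - c t"] by simp
    then have "n < d1" "n < d2" using near by linarith+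
    then have "G (s, c s) = 0" using d2(2)[of "(s, c s)"] s unfolding n_def by (simp add: dist_norm)
    with d1(2)[of "(s, c s)"] \<open>n < d1\<close> G0
    have "\<bar>\<kappa>\<bar> * \<bar>s - t\<bar> \<le> \<epsilon> * n" unfolding n_def by (simp add: abs_mult)
    also have "\<dots> \<le> \<epsilon> * (\<bar>s - t\<bar> + \<bar>c s - c t\<bar>)" using n \<open>\<epsilon> > 0\<close> by simp
    also have "\<dots> = \<bar>\<kappa>\<bar> * (\<delta> * (\<bar>s - t\<bar> + \<bar>c s - c t\<bar>) / (1 + \<delta>))" unfolding \<epsilon>_def by simp
    finally have "\<bar>s - t\<bar> \<le> \<delta> * (\<bar>s - t\<bar> + \<bar>c s - c t\<bar>) / (1 + \<delta>)"
      using k0 by (simp only: mult_le_cancel_left_pos zero_less_abs_iff simp_thms)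
    then show "\<bar>s - t\<bar> \<le> \<delta> * \<bar>c s - c t\<bar>" using \<open>\<delta> > 0\<close> by (simp add: field_simps)
  qed
qed

section \<open>Linear algebra of a symplectic form\<close>

lemma symplectic_form_skew:
  assumes "symplectic_form \<omega>"
  shows "\<omega> u v = - \<omega> v u"
proof -
  have bil: "bilinear \<omega>" and alt: "\<And>v. \<omega> v v = 0"
    using assms unfolding symplectic_form_def by auto
  have "\<omega> (u + v) (u + v) = \<omega> u u + \<omega> u v + (\<omega> v u + \<omega> v v)"
    by (simp add: bilinear_ladd[OF bil] bilinear_radd[OF bil])
  then show ?thesis using alt by simp
qed

text \<open>Nondegeneracy makes the map from \<open>u\<close> to the form \<open>\<omega> u\<close>
  injective. Read in coordinates over \<open>Basis\<close>, it is an injective endomorphism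
  \<open>T\<close>, hence surjective.\<close>

lemma symplectic_form_represents:
  fixes \<omega> :: "'a::euclidean_space \<Rightarrow> 'a \<Rightarrow> real"
  assumes "symplectic_form \<omega>" and \<phi>: "linear \<phi>"
  obtains u where "\<phi> = \<omega> u"
proof -
  have bil: "bilinear \<omega>" and nondeg: "\<And>v. (\<And>w. \<omega> v w = 0) \<Longrightarrow> v = 0"
    using assms unfolding symplectic_form_def by auto
  have linr: "linear (\<omega> u)" for u using bil unfolding bilinear_def by blast
  define T where "T = (\<lambda>u. \<Sum>e\<in>Basis. \<omega> u e *\<^sub>R e)"
  have Te: "T u \<bullet> e = \<omega> u e" if "e \<in> Basis" for u e
    unfolding T_def using that by simp
  have "linear T"
    unfolding T_def
    by (rule linearI) (simp_all add: bilinear_ladd[OF bil] bilinear_lmul[OF bil]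
        scaleR_add_left sum.distrib scaleR_sum_right)
  moreover have "inj T"
    unfolding linear_injective_0[OF \<open>linear T\<close>]
  proof (intro allI impI)
    fix u assume "T u = 0"
    then have "\<omega> u e = 0" if "e \<in> Basis" for e using Te[OF that, of u] by simp
    then have "\<omega> u = (\<lambda>_. 0)"
      by (intro linear_eq_stdbasis[OF linr]) (auto simp: linear_zero)
    then show "u = 0" using nondeg by metis
  qed
  ultimately obtain u where "T u = (\<Sum>e\<in>Basis. \<phi> e *\<^sub>R e)"
    using linear_injective_imp_surjective by (metis surjD)
  then have "\<phi> e = \<omega> u e" if "e \<in> Basis" for e
    using Te[OF that, of u] that by simp
  then have "\<phi> = \<omega> u" by (intro linear_eq_stdbasis[OF \<phi> linr]) auto
  then show thesis by (rule that)
qed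

section \<open>Lifts of the billiard correspondence\<close>

lemma proj_smooth_fun_has_derivative:
  fixes z :: "'a::euclidean_space"
  assumes "proj_smooth_fun N h" "z \<noteq> 0" "span {z} \<in> N"
  shows "((\<lambda>v. h (span {v})) has_derivative frechet_derivative (\<lambda>v. h (span {v})) (at z)) (at z)"
proof -
  have "Ck_on (Suc 0) (\<lambda>v. h (span {v})) {v. v \<noteq> 0 \<and> span {v} \<in> N}"
    using assms(1) unfolding proj_smooth_fun_def smooth_on_def by blast
  then show ?thesis using assms frechet_derivative_works by auto
qed

text \<open>The function is constant on the ray through \<open>z\<close>, so its derivative in the
  direction \<open>z\<close> vanishes.\<close>

lemma proj_fun_derivative_radial:
  fixes z :: "'a::euclidean_space"
  assumes D: "((\<lambda>v. h (span {v})) has_derivative D) (at z)"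
  shows "D z = (0::real)"
proof -
  have g: "((\<lambda>t::real. (1 + t) *\<^sub>R z) has_derivative (\<lambda>t. t *\<^sub>R z)) (at 0)"
    by (auto intro!: derivative_eq_intros)
  have "((\<lambda>t. h (span {(1 + t) *\<^sub>R z})) has_derivative (\<lambda>t. D (t *\<^sub>R z))) (at (0::real))"
    using has_derivative_compose[OF g] D by simp
  moreover have "h (span {(1 + t) *\<^sub>R z}) = h (span {z})" if "t \<in> {-1<..}" for t :: real
  proof -
    have "1 + t \<noteq> 0" using that by auto
    from span_sing_scale[OF this, of z] show ?thesis by (rule arg_cong)
  qed
  ultimately have "((\<lambda>t. h (span {z})) has_derivative (\<lambda>t. D (t *\<^sub>R z))) (at (0::real))"
    by (elim has_derivative_transform_within_open[where s = "{-1<..}"]) auto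
  then have "(\<lambda>t. D (t *\<^sub>R z)) = (\<lambda>t. 0)"
    using has_derivative_unique has_derivative_const by blast
  then have "D (1 *\<^sub>R z) = 0" by meson
  then show ?thesis by simp
qed

text \<open>Given lifts \<open>w\<close> and \<open>y\<close> of the two points, one scalar
  \<open>c\<close> suffices to recover both \<open>q\<close> and its contact point, as the lines of
  \<open>w + c y\<close> and \<open>w - c y\<close>. The last conclusion expresses by \<omega> that
  the second point is the contact point of the tangent hyperplane at the first.\<close>

lemma outer_contact_billiard_lifts:
  fixes \<omega> :: "'a::euclidean_space \<Rightarrow> 'a \<Rightarrow> real"
  assumes sym: "symplectic_form \<omega>" and S: "proj_hypersurface S"
    and bil: "outer_contact_billiard \<omega> S (span {w}) (span {y})"
    and w0: "w \<noteq> 0" and y0: "y \<noteq> 0"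
  obtains c N h m where "\<omega> w y = 0" "w + c *\<^sub>R y \<noteq> 0" "span {w + c *\<^sub>R y} \<in> S"
    "defining_fun S (span {w + c *\<^sub>R y}) N h" "m \<noteq> 0"
    "((\<lambda>v. h (span {v})) has_derivative (\<lambda>v. m * \<omega> (w - c *\<^sub>R y) v)) (at (w + c *\<^sub>R y))"
proof -
  have om: "bilinear \<omega>" and alt: "\<And>v. \<omega> v v = 0"
    using sym unfolding symplectic_form_def by auto
  obtain q where q: "q \<in> S" and harm: "harmonic_conjugates q (symp_perp \<omega> (tangent_hyperplane S q)) (span {w}) (span {y})"
    using bil unfolding outer_contact_billiard_def Let_def by blast
  then obtain a b where ab: "a \<noteq> 0" "b \<noteq> 0" "q = span {a}"
    "symp_perp \<omega> (tangent_hyperplane S q) = span {b}" "span {w} = span {a + b}" "span {y} = span {a - b}"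
    unfolding harmonic_conjugates_def by blast
  have "w \<in> span {a + b}" "y \<in> span {a - b}" using ab span_base by blast+
  then obtain k l where k: "w = k *\<^sub>R (a + b)" and l: "y = l *\<^sub>R (a - b)"
    by (auto simp: span_singleton)
  have "k \<noteq> 0" "l \<noteq> 0" using k l w0 y0 by auto
  \<comment> \<open>This scalar gives \<open>y\<close> the same factor \<open>k\<close> as
    \<open>w\<close>, so that sum and difference become multiples of \<open>a\<close> and of
    \<open>b\<close>.\<close>
  define c where "c = k / l"
  have "c \<noteq> 0" using \<open>k \<noteq> 0\<close> \<open>l \<noteq> 0\<close> unfolding c_def by simp
  have cy: "c *\<^sub>R y = k *\<^sub>R (a - b)" using l \<open>l \<noteq> 0\<close> unfolding c_def by simp
  have A: "w + c *\<^sub>R y = (2 * k) *\<^sub>R a" and B: "w - c *\<^sub>R y = (2 * k) *\<^sub>R b"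
    unfolding cy k by (simp_all add: algebra_simps flip: scaleR_2)
  let ?z = "w + c *\<^sub>R y"
  have z0: "?z \<noteq> 0" using A ab(1) \<open>k \<noteq> 0\<close> by simp
  have zq: "span {?z} = q" unfolding A ab(3) using \<open>k \<noteq> 0\<close> by (intro span_sing_scale) simp
  obtain N h where def: "defining_fun S q N h" using S q unfolding proj_hypersurface_def by blast
  let ?D = "frechet_derivative (\<lambda>v. h (span {v})) (at ?z)"
  have zz: "?z \<in> q - {0}" using z0 zq span_base by blast
  have D: "((\<lambda>v. h (span {v})) has_derivative ?D) (at ?z)"
    using def zq z0 unfolding defining_fun_def
    by (intro proj_smooth_fun_has_derivative[where N = N]) auto
  have D0: "?D \<noteq> (\<lambda>v. 0)" using def zz unfolding defining_fun_def by blast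
  obtain u where u: "?D = \<omega> u"
    using symplectic_form_represents[OF sym has_derivative_linear[OF D]] .
  \<comment> \<open>The tangent hyperplane lies in the kernel of \<open>?D\<close>, so
    \<open>u\<close> lies in the line \<open>span {b}\<close> of the contact point.\<close>
  have "u \<in> symp_perp \<omega> (tangent_hyperplane S q)"
  proof -
    have "?D v = 0" if "v \<in> tangent_hyperplane S q" for v
      using that def zz unfolding tangent_hyperplane_def by blast
    then show ?thesis unfolding symp_perp_def u by simp
  qed
  then obtain m' where m': "u = m' *\<^sub>R b" unfolding ab(4) by (auto simp: span_singleton)
  define m where "m = m' / (2 * k)"
  have um: "u = m *\<^sub>R (w - c *\<^sub>R y)" unfolding B m' m_def using \<open>k \<noteq> 0\<close> by simp
  then have Dm: "?D = (\<lambda>v. m * \<omega> (w - c *\<^sub>R y) v)"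
    unfolding u by (simp add: bilinear_lmul[OF om] fun_eq_iff)
  have m0: "m \<noteq> 0" using D0 Dm by auto
  \<comment> \<open>Evaluating at the radial vector gives 2 c \<omega>(w, y) = 0.\<close>
  have "?D ?z = 0" using proj_fun_derivative_radial[OF D] .
  then have "\<omega> (w - c *\<^sub>R y) (w + c *\<^sub>R y) = 0" using Dm m0 by (metis mult_eq_0_iff)
  then have "\<omega> w w + c * \<omega> w y - c * \<omega> y w - c * c * \<omega> y y = 0"
    by (simp add: bilinear_lsub[OF om] bilinear_radd[OF om] bilinear_lmul[OF om]
        bilinear_rmul[OF om] algebra_simps)
  then have wy: "\<omega> w y = 0"
    using alt symplectic_form_skew[OF sym, of y w] \<open>c \<noteq> 0\<close> by simp
  show thesis
    by (rule that[of c N h m]) (use wy z0 zq q def m0 D Dm in simp_all)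
qed

section \<open>Sign of the product of the two contact forms\<close>

text \<open>A negative product at \<open>z\<close> stays negative along a segment in the direction
  \<open>v\<close>. There the chosen coefficients \<open>c t\<close> form a graph contained locally
  in zero sets of functions with differential \<kappa> dt, \<kappa> \<noteq> 0, contrary to
  \<open>no_transversal_envelope\<close>.\<close>

lemma billiard_lift_forms_same_sign:
  fixes \<omega> :: "'a::euclidean_space \<Rightarrow> 'a \<Rightarrow> real"
  assumes sym: "symplectic_form \<omega>" and S: "proj_hypersurface S"
    and L: "is_lift F W f" and z: "z \<in> W"
    and bil: "\<And>w. w \<in> W \<Longrightarrow> outer_contact_billiard \<omega> S (span {w}) (F (span {w}))"
  shows "0 \<le> \<omega> z v * \<omega> (f z) (frechet_derivative f (at z) v)"
proof (rule ccontr)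
  define D where "D = (\<lambda>w. frechet_derivative f (at w) v)"
  assume "\<not> ?thesis"
  then have neg: "\<omega> z v * \<omega> (f z) (D z) < 0" unfolding D_def by simp
  have om: "bilinear \<omega>" using sym unfolding symplectic_form_def by auto
  then interpret om: bounded_bilinear \<omega> by (simp add: bilinear_conv_bounded_bilinear)
  have W: "open W" and W0: "\<And>w. w \<in> W \<Longrightarrow> w \<noteq> 0 \<and> f w \<noteq> 0 \<and> F (span {w}) = span {f w}"
    using L unfolding is_lift_def by auto
  note Df = is_lift_has_derivative[OF L]
  have lift: "\<exists>c N h m. w + c *\<^sub>R f w \<noteq> 0 \<and> span {w + c *\<^sub>R f w} \<in> S \<and>
    defining_fun S (span {w + c *\<^sub>R f w}) N h \<and> m \<noteq> 0 \<and>
    ((\<lambda>v. h (span {v})) has_derivative (\<lambda>v. m * \<omega> (w - c *\<^sub>R f w) v)) (at (w + c *\<^sub>R f w))"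
    and wf: "\<omega> w (f w) = 0" if w: "w \<in> W" for w
  proof -
    have "outer_contact_billiard \<omega> S (span {w}) (span {f w})"
      using bil[OF w] W0[OF w] by simp
    then obtain c N h m where "\<omega> w (f w) = 0" "w + c *\<^sub>R f w \<noteq> 0" "span {w + c *\<^sub>R f w} \<in> S"
      "defining_fun S (span {w + c *\<^sub>R f w}) N h" "m \<noteq> 0"
      "((\<lambda>v. h (span {v})) has_derivative (\<lambda>v. m * \<omega> (w - c *\<^sub>R f w) v)) (at (w + c *\<^sub>R f w))"
      using W0[OF w] by (elim outer_contact_billiard_lifts[OF sym S]) auto
    then show "\<exists>c N h m. w + c *\<^sub>R f w \<noteq> 0 \<and> span {w + c *\<^sub>R f w} \<in> S \<and>
      defining_fun S (span {w + c *\<^sub>R f w}) N h \<and> m \<noteq> 0 \<and>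
      ((\<lambda>v. h (span {v})) has_derivative (\<lambda>v. m * \<omega> (w - c *\<^sub>R f w) v)) (at (w + c *\<^sub>R f w))"
      and "\<omega> w (f w) = 0" by blast+
  qed
  \<comment> \<open>Differentiating \<omega>(w, f(w)) = 0 along \<open>v\<close> gives this
    identity. It cancels the terms linear in \<open>c\<close> in the computation of
    \<kappa>.\<close>
  have cross: "\<omega> w (D w) = \<omega> (f w) v" if w: "w \<in> W" for w
  proof -
    have "((\<lambda>w. \<omega> w (f w)) has_derivative
        (\<lambda>h. \<omega> w (frechet_derivative f (at w) h) + \<omega> h (f w))) (at w)"
      by (rule om.FDERIV[OF has_derivative_ident Df[OF w]])
    from has_derivative_transform_within_open[OF this W w, of "\<lambda>_. 0"]
    have "((\<lambda>w. 0) has_derivative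
        (\<lambda>h. \<omega> w (frechet_derivative f (at w) h) + \<omega> h (f w))) (at w)"
      using wf by simp
    then have "(\<lambda>h. \<omega> w (frechet_derivative f (at w) h) + \<omega> h (f w)) = (\<lambda>_. 0)"
      using has_derivative_unique has_derivative_const by blast
    then have "\<omega> w (D w) + \<omega> v (f w) = 0" unfolding D_def by meson
    then show ?thesis using symplectic_form_skew[OF sym, of "f w" v] by simp
  qed
  \<comment> \<open>The second clause of \<open>Ck_on (Suc 0)\<close> supplies continuity of the
    directional derivative \<open>D\<close>, so negativity of the product is an open
    condition.\<close>
  have "Ck_on (Suc 0) f W" using L unfolding is_lift_def smooth_on_def by blast
  then have contD: "continuous_on W D" unfolding D_def by simp
  have contf: "continuous_on W f"
    using Df by (meson has_derivative_continuous continuous_at_imp_continuous_on)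
  have "continuous_on W (\<lambda>w. \<omega> w v * \<omega> (f w) (D w))"
    by (intro continuous_intros om.continuous_on contD contf)
  then have "open (W \<inter> (\<lambda>w. \<omega> w v * \<omega> (f w) (D w)) -` {..<0})"
    using W by (simp add: continuous_on_open_vimage Int_commute)
  moreover have "((\<lambda>t::real. z + t *\<^sub>R v) \<longlongrightarrow> z + 0 *\<^sub>R v) (at 0)" by (intro tendsto_intros)
  ultimately have "\<forall>\<^sub>F t in at (0::real). z + t *\<^sub>R v \<in> W \<inter> (\<lambda>w. \<omega> w v * \<omega> (f w) (D w)) -` {..<0}"
    using z neg by (auto dest!: topological_tendstoD)
  then obtain e where e: "e > 0" "\<And>t. \<lbrakk>t \<noteq> 0; \<bar>t\<bar> < e\<rbrakk> \<Longrightarrow>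
      z + t *\<^sub>R v \<in> W \<and> \<omega> (z + t *\<^sub>R v) v * \<omega> (f (z + t *\<^sub>R v)) (D (z + t *\<^sub>R v)) < 0"
    unfolding eventually_at by (auto simp: dist_real_def)
  define x where "x = (\<lambda>t::real. z + t *\<^sub>R v)"
  have I: "x t \<in> W" "\<omega> (x t) v * \<omega> (f (x t)) (D (x t)) < 0" if "t \<in> {0<..<e}" for t
    using e(2)[of t] that unfolding x_def by auto
  \<comment> \<open>\<open>K w c\<close> says that \<open>c\<close> is an admissible coefficient at
    \<open>w\<close>. Choosing one for each \<open>t\<close> yields a function \<open>c\<close>
    without any regularity.\<close>
  define K where "K = (\<lambda>w c. w + c *\<^sub>R f w \<noteq> 0 \<and> span {w + c *\<^sub>R f w} \<in> S \<and>
    (\<exists>N h m. defining_fun S (span {w + c *\<^sub>R f w}) N h \<and> m \<noteq> 0 \<and>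
    ((\<lambda>v. h (span {v})) has_derivative (\<lambda>v. m * \<omega> (w - c *\<^sub>R f w) v)) (at (w + c *\<^sub>R f w))))"
  have "\<forall>t\<in>{0<..<e}. \<exists>c. K (x t) c" unfolding K_def using lift I(1) by blast
  then obtain c where c: "\<And>t. t \<in> {0<..<e} \<Longrightarrow> K (x t) (c t)" by metis
  show False
  proof (rule no_transversal_envelope[OF e(1), of c])
    fix t assume t: "t \<in> {0<..<e}"
    let ?w = "x t" and ?c = "c t"
    define A where "A = (\<lambda>p. x (fst p) + snd p *\<^sub>R f (x (fst p)))"
    have At: "A (t, ?c) = ?w + ?c *\<^sub>R f ?w" unfolding A_def by simp
    obtain N h m where a0: "A (t, ?c) \<noteq> 0" and aS: "span {A (t, ?c)} \<in> S"
      and def: "defining_fun S (span {A (t, ?c)}) N h" and m: "m \<noteq> 0"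
      and H: "((\<lambda>v. h (span {v})) has_derivative (\<lambda>v. m * \<omega> (?w - ?c *\<^sub>R f ?w) v)) (at (A (t, ?c)))"
      using c[OF t] unfolding K_def At by blast
    have N: "openin proj_topology N" "span {A (t, ?c)} \<in> N" "S \<inter> N = {p \<in> N. h p = 0}"
      using def unfolding defining_fun_def by auto
    define \<kappa> where "\<kappa> = m * (\<omega> ?w v - ?c * ?c * \<omega> (f ?w) (D ?w))"
    \<comment> \<open>If this difference vanished, the product of the two forms would be a square,
      against the assumed negative sign.\<close>
    have "\<omega> ?w v - ?c * ?c * \<omega> (f ?w) (D ?w) \<noteq> 0"
    proof
      assume "\<omega> ?w v - ?c * ?c * \<omega> (f ?w) (D ?w) = 0"
      then have "\<omega> ?w v * \<omega> (f ?w) (D ?w) = (?c * \<omega> (f ?w) (D ?w))\<^sup>2"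
        by (simp add: power2_eq_square)
      then show False using I(2)[OF t] by (metis not_less zero_le_power2)
    qed
    then have \<kappa>0: "\<kappa> \<noteq> 0" using m unfolding \<kappa>_def by simp
    have dx: "((\<lambda>p::real \<times> real. x (fst p)) has_derivative (\<lambda>p. fst p *\<^sub>R v)) (at (t, ?c))"
      unfolding x_def by (auto intro!: derivative_eq_intros)
    have "(f has_derivative frechet_derivative f (at ?w)) (at (x (fst (t, ?c))))"
      using Df[OF I(1)[OF t]] by simp
    from has_derivative_compose[OF dx this]
    have dfx: "((\<lambda>p. f (x (fst p))) has_derivative
        (\<lambda>p. frechet_derivative f (at ?w) (fst p *\<^sub>R v))) (at (t, ?c))" .
    have linD: "linear (frechet_derivative f (at ?w))"
      using Df[OF I(1)[OF t]] has_derivative_linear by blast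
    have dA: "(A has_derivative (\<lambda>p. fst p *\<^sub>R v + (?c *\<^sub>R (fst p *\<^sub>R D ?w) + snd p *\<^sub>R f ?w))) (at (t, ?c))"
      unfolding A_def
      using has_derivative_add[OF dx has_derivative_scaleR[OF has_derivative_snd[OF has_derivative_ident] dfx]]
      by (simp add: D_def linear_cmul[OF linD])
    \<comment> \<open>The component along \<open>f ?w\<close> contributes nothing because
      \<omega>(w, f(w)) = \<omega>(f(w), f(w)) = 0, so the derivative in the second variable is
      zero.\<close>
    have GD: "((\<lambda>p. h (span {A p})) has_derivative (\<lambda>p. \<kappa> * fst p)) (at (t, ?c))"
    proof -
      have "m * \<omega> (?w - ?c *\<^sub>R f ?w) (fst p *\<^sub>R v + (?c *\<^sub>R (fst p *\<^sub>R D ?w) + snd p *\<^sub>R f ?w)) = \<kappa> * fst p"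
        for p :: "real \<times> real"
        using wf[OF I(1)[OF t]] cross[OF I(1)[OF t]] sym
        unfolding \<kappa>_def symplectic_form_def
        by (simp add: om.diff_left om.add_right om.scaleR_left om.scaleR_right algebra_simps)
      then show ?thesis using has_derivative_compose[OF dA H] by simp
    qed
    \<comment> \<open>By continuity \<open>A p\<close> stays over \<open>N\<close>, where
      \<open>h\<close> cuts out \<open>S\<close>. For \<open>p\<close> on the graph of
      \<open>c\<close>, it also lies over \<open>S\<close> by the choice of
      \<open>c\<close>.\<close>
    have "isCont A (t, ?c)" using has_derivative_continuous[OF dA] .
    then have "(A \<longlongrightarrow> A (t, ?c)) (nhds (t, ?c))"
      by (simp add: isCont_def tendsto_at_iff_tendsto_nhds)
    moreover have "open {v. v \<noteq> 0 \<and> span {v} \<in> N}" using N(1) unfolding openin_proj_topology by blast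
    ultimately have "\<forall>\<^sub>F p in nhds (t, ?c). A p \<in> {v. v \<noteq> 0 \<and> span {v} \<in> N}"
      using a0 N(2) by (auto dest!: topological_tendstoD)
    then have ev: "\<forall>\<^sub>F p in nhds (t, ?c).
        fst p \<in> {0<..<e} \<and> snd p = c (fst p) \<longrightarrow> h (span {A p}) = 0"
    proof eventually_elim
      case (elim p)
      show ?case
      proof
        assume p: "fst p \<in> {0<..<e} \<and> snd p = c (fst p)"
        then have "span {A p} \<in> S" using c[of "fst p"] unfolding K_def A_def by auto
        then show "h (span {A p}) = 0" using elim N(3) by blast
      qed
    qed
    show "\<exists>G \<kappa>. \<kappa> \<noteq> 0 \<and> G (t, ?c) = 0 \<and> (G has_derivative (\<lambda>p. \<kappa> * fst p)) (at (t, ?c)) \<and>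
      (\<forall>\<^sub>F p in nhds (t, ?c). fst p \<in> {0<..<e} \<and> snd p = c (fst p) \<longrightarrow> G p = 0)"
      by (rule exI[of _ "\<lambda>p. h (span {A p})"], rule exI[of _ \<kappa>])
        (use \<kappa>0 GD ev aS N in auto)
  qed
qed

section \<open>Kernels of forms and differentials of lifts\<close>

text \<open>Otherwise, moving from \<open>v\<close> along \<open>u\<close> would keep \<alpha> fixed
  while \<beta> takes every value, in particular the value -\<alpha>(v), which makes the product
  negative.\<close>

lemma kernel_subset_of_same_sign:
  fixes \<alpha> \<beta> :: "'a::real_vector \<Rightarrow> real"
  assumes "linear \<alpha>" "linear \<beta>" and same: "\<And>v. 0 \<le> \<alpha> v * \<beta> v"
    and "\<alpha> v \<noteq> 0" and "\<alpha> u = 0"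
  shows "\<beta> u = 0"
proof (rule ccontr)
  assume b: "\<beta> u \<noteq> 0"
  define s where "s = (- \<alpha> v - \<beta> v) / \<beta> u"
  have "\<alpha> (v + s *\<^sub>R u) = \<alpha> v"
    using assms by (simp add: linear_add linear_cmul)
  moreover have "\<beta> (v + s *\<^sub>R u) = - \<alpha> v"
    using assms b by (simp add: linear_add linear_cmul s_def)
  ultimately have "0 \<le> - (\<alpha> v * \<alpha> v)" using same[of "v + s *\<^sub>R u"] by simp
  then show False using assms(4) by (metis neg_0_le_iff_le not_real_square_gt_zero not_le)
qed

text \<open>Near \<open>z\<close> the map multiplies \<open>w\<close> by a scalar
  \<open>lam w\<close>, which is differentiable at \<open>z\<close> as a quotient of inner products.
  The product rule then gives the form of the derivative. It serves for a lift of \<open>F\<close>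
  followed by a lift of its inverse.\<close>

lemma derivative_line_preserving:
  fixes p :: "'a::euclidean_space \<Rightarrow> 'a"
  assumes D: "(p has_derivative p') (at z)" and z0: "z \<noteq> 0"
    and ev: "\<forall>\<^sub>F w in nhds z. p w \<in> span {w}"
  obtains \<mu> d where "p z = \<mu> *\<^sub>R z" "p' v = \<mu> *\<^sub>R v + d *\<^sub>R z"
proof -
  define lam where "lam = (\<lambda>w. (p w \<bullet> w) / (w \<bullet> w))"
  have "lam differentiable (at z)"
    unfolding lam_def
    by (intro differentiable_divide differentiable_inner)
       (use D z0 in \<open>auto simp: differentiable_def\<close>)
  then obtain lam' where lam': "(lam has_derivative lam') (at z)"
    unfolding differentiable_def by blast
  have rel: "p w = lam w *\<^sub>R w" if "p w \<in> span {w}" for w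
    using that unfolding lam_def by (auto simp: span_singleton)
  have at: "p z = lam z *\<^sub>R z" using rel eventually_nhds_x_imp_x[OF ev] by blast
  have "\<forall>\<^sub>F w in at z. p w = lam w *\<^sub>R w"
    using ev rel unfolding eventually_at_filter by (auto elim: eventually_mono)
  then have "((\<lambda>w. lam w *\<^sub>R w) has_derivative p') (at z)"
    by (rule has_derivative_transform_eventually[OF D]) (use at in auto)
  moreover have "((\<lambda>w. lam w *\<^sub>R w) has_derivative (\<lambda>w. lam z *\<^sub>R w + lam' w *\<^sub>R z)) (at z)"
    using has_derivative_scaleR[OF lam' has_derivative_ident] .
  ultimately have "p' = (\<lambda>w. lam z *\<^sub>R w + lam' w *\<^sub>R z)"
    by (rule has_derivative_unique)
  then show thesis using that at by blast
qed

text \<open>This is surjectivity of the differential of a diffeomorphism, read in lifts. A lift of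
  the inverse shows injectivity modulo the lines of \<open>z\<close> and \<open>f z\<close>, and a
  rank-one correction of the derivative turns this into bijectivity of an endomorphism
  \<open>T\<close>.\<close>

lemma lift_derivative_surj_mod_line:
  fixes f :: "'a::euclidean_space \<Rightarrow> 'a"
  assumes dif: "proj_diffeo N M F" and L: "is_lift F W f" and z: "z \<in> W" and zN: "span {z} \<in> N"
  obtains v d where "u = frechet_derivative f (at z) v + d *\<^sub>R f z"
proof -
  let ?D = "frechet_derivative f (at z)"
  have z0: "z \<noteq> 0" and fz0: "f z \<noteq> 0" and Fz: "F (span {z}) = span {f z}" and W: "open W"
    using L z unfolding is_lift_def by auto
  have bij: "bij_betw F N M" and oN: "open {v. v \<noteq> 0 \<and> span {v} \<in> N}"
    and invs: "proj_smooth_on M (inv_into N F)"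
    using dif unfolding proj_diffeo_def openin_proj_topology by auto
  have "span {f z} \<in> M" using bij zN Fz by (metis bij_betwE)
  then obtain W' g where W': "f z \<in> W'" "is_lift (inv_into N F) W' g"
    using invs fz0 unfolding proj_smooth_on_def by blast
  let ?E = "frechet_derivative g (at (f z))"
  have Df: "(f has_derivative ?D) (at z)" and Dg: "(g has_derivative ?E) (at (f z))"
    using is_lift_has_derivative L z W' by blast+
  have linD: "linear ?D" and linE: "linear ?E" using Df Dg has_derivative_linear by blast+
  have gfz0: "g (f z) \<noteq> 0" using W' unfolding is_lift_def by blast
  have "(f \<longlongrightarrow> f z) (nhds z)"
    using has_derivative_continuous[OF Df] by (simp add: isCont_def tendsto_at_iff_tendsto_nhds)
  moreover have "open W'" using W' unfolding is_lift_def by blast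
  ultimately have "\<forall>\<^sub>F w in nhds z. f w \<in> W'" using W' by (auto dest!: topological_tendstoD)
  moreover have "\<forall>\<^sub>F w in nhds z. w \<in> W" using W z by (rule eventually_nhds_in_open)
  moreover have "\<forall>\<^sub>F w in nhds z. w \<in> {v. v \<noteq> 0 \<and> span {v} \<in> N}"
    using oN z0 zN by (intro eventually_nhds_in_open) auto
  ultimately have ev: "\<forall>\<^sub>F w in nhds z. g (f w) \<in> span {w}"
  proof eventually_elim
    case (elim w)
    have "span {g (f w)} = inv_into N F (span {f w})" using W' elim unfolding is_lift_def by auto
    also have "span {f w} = F (span {w})" using L elim unfolding is_lift_def by auto
    also have "inv_into N F (F (span {w})) = span {w}"
      using bij elim by (simp add: bij_betw_def inv_into_f_f)
    finally show ?case using span_base by blast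
  qed
  \<comment> \<open>The derivative of the composite is multiplication by \<mu> \<noteq> 0 modulo
    \<open>z\<close>. If \<open>?D v\<close> is radial, its image under \<open>?E\<close> is radial
    too, so \<open>v\<close> is a multiple of \<open>z\<close>.\<close>
  have kernel: "v \<in> span {z}" if "?D v \<in> span {f z}" for v
  proof -
    obtain d where d: "?D v = d *\<^sub>R f z" using \<open>?D v \<in> span {f z}\<close> by (auto simp: span_singleton)
    obtain m where m: "?E (f z) = m *\<^sub>R g (f z)"
      using lift_derivative_radial[OF W'(2,1)] by blast
    obtain \<mu> d' where \<mu>: "g (f z) = \<mu> *\<^sub>R z" "?E (?D v) = \<mu> *\<^sub>R v + d' *\<^sub>R z"
      using derivative_line_preserving[OF has_derivative_compose[OF Df Dg] z0 ev] .
    have "\<mu> \<noteq> 0" using gfz0 \<mu>(1) by auto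
    have "?E (?D v) = (d * m * \<mu>) *\<^sub>R z"
      unfolding d using m \<mu>(1) by (simp add: linear_cmul[OF linE])
    then have "\<mu> *\<^sub>R v = (d * m * \<mu> - d') *\<^sub>R z" using \<mu>(2) by (simp add: algebra_simps)
    then have "v = ((d * m * \<mu> - d') / \<mu>) *\<^sub>R z"
      using \<open>\<mu> \<noteq> 0\<close> by (metis (no_types, lifting) divide_inverse_commute scaleR_left_imp_eq
          scaleR_scaleR nonzero_mult_div_cancel_left times_divide_eq_right)
    then show ?thesis by (metis span_mul span_base singletonI)
  qed
  obtain m where m: "?D z = m *\<^sub>R f z" using lift_derivative_radial[OF L z] by blast
  \<comment> \<open>Since \<open>?D z = m f z\<close>, this \<open>r\<close> normalizes the
    correction so that \<open>T z = f z\<close>; thus \<open>T\<close> is injective also on the line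
    of \<open>z\<close>.\<close>
  define r where "r = (1 - m) / (z \<bullet> z)"
  have r: "m + r * (z \<bullet> z) = 1" unfolding r_def using z0 by simp
  define T where "T = (\<lambda>v. ?D v + (r * (z \<bullet> v)) *\<^sub>R f z)"
  have "linear T"
    unfolding T_def
    by (rule linearI) (simp_all add: linear_add[OF linD] linear_cmul[OF linD] inner_add_right algebra_simps)
  moreover have "inj T"
    unfolding linear_injective_0[OF \<open>linear T\<close>]
  proof (intro allI impI)
    fix v assume "T v = 0"
    then have "?D v = (- (r * (z \<bullet> v))) *\<^sub>R f z"
      unfolding T_def by (metis add_eq_0_iff2 scaleR_minus_left)
    then have "?D v \<in> span {f z}" by (metis span_mul span_base singletonI)
    then obtain k where k: "v = k *\<^sub>R z" using kernel by (auto simp: span_singleton)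
    have "T v = (k * (m + r * (z \<bullet> z))) *\<^sub>R f z"
      unfolding T_def k using m by (simp add: linear_cmul[OF linD] algebra_simps)
    then have "T v = k *\<^sub>R f z" using r by simp
    then show "v = 0" using \<open>T v = 0\<close> fz0 k by simp
  qed
  ultimately have "surj T" using linear_injective_imp_surjective by blast
  then obtain v where "u = T v" by (metis surjD)
  then show thesis unfolding T_def using that by blast
qed

section \<open>Contact planes and their images\<close>

text \<open>Rescaling a representative to the fixed lift \<open>z\<close> preserves the condition on
  \<open>v\<close>, so one lift yields the whole contact plane.\<close>

lemma contact_plane_span:
  assumes om: "bilinear \<omega>" and z0: "z \<noteq> 0"
  shows "contact_plane \<omega> (span {z}) = {tangent_vec z v | v. \<omega> v z = 0}"
proof (intro equalityI subsetI)
  fix X assume "X \<in> contact_plane \<omega> (span {z})"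
  then obtain z' v where X: "X = tangent_vec z' v" "z' \<in> span {z} - {0}" "v \<in> symp_perp \<omega> (span {z})"
    unfolding contact_plane_def by blast
  obtain k where k: "z' = k *\<^sub>R z" using X(2) by (auto simp: span_singleton)
  have "k \<noteq> 0" using k X(2) by auto
  have "X = tangent_vec z ((1 / k) *\<^sub>R v)"
    unfolding X(1) by (rule tangent_vec_eqI[of k _ _ _ _ 0]) (use k \<open>k \<noteq> 0\<close> in auto)
  moreover have "\<omega> v z = 0" using X(3) span_base unfolding symp_perp_def by blast
  ultimately show "X \<in> {tangent_vec z v | v. \<omega> v z = 0}"
    by (auto simp: bilinear_lmul[OF om])
next
  fix X assume "X \<in> {tangent_vec z v | v. \<omega> v z = 0}"
  then obtain v where X: "X = tangent_vec z v" "\<omega> v z = 0" by blast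
  have "v \<in> symp_perp \<omega> (span {z})"
    using X(2) unfolding symp_perp_def by (auto simp: span_singleton bilinear_rmul[OF om])
  moreover have "z \<in> span {z} - {0}" using z0 span_base by blast
  ultimately show "X \<in> contact_plane \<omega> (span {z})" unfolding contact_plane_def X(1) by blast
qed

lemma Ck_on_subset: "\<lbrakk>Ck_on k f S; T \<subseteq> S\<rbrakk> \<Longrightarrow> Ck_on k f T"
  by (induction k arbitrary: f) (auto intro: continuous_on_subset)

lemma is_lift_subset: "\<lbrakk>is_lift F W f; open V; V \<subseteq> W\<rbrakk> \<Longrightarrow> is_lift F V f"
  unfolding is_lift_def smooth_on_def by (meson Ck_on_subset subsetD)

theorem theorem5p1:
  fixes \<omega> :: "'a::euclidean_space \<Rightarrow> 'a \<Rightarrow> real"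
    and S U :: "'a set set"
    and F :: "'a set \<Rightarrow> 'a set"
  assumes "symplectic_form \<omega>"
    and "proj_hypersurface S"
    and "openin proj_topology U"
    and "proj_local_diffeo U F"
    and "\<forall>Z\<in>U. outer_contact_billiard \<omega> S Z (F Z)"
  shows "\<forall>Z\<in>U. proj_deriv F Z ` contact_plane \<omega> Z = contact_plane \<omega> (F Z)"
proof
  fix Z assume "Z \<in> U"
  have om: "bilinear \<omega>" and nondeg: "\<And>v. (\<And>w. \<omega> v w = 0) \<Longrightarrow> v = 0"
    using assms(1) unfolding symplectic_form_def by auto
  note skew = symplectic_form_skew[OF assms(1)]
  have linr: "linear (\<omega> u)" for u using om unfolding bilinear_def by blast
  obtain N M where NM: "Z \<in> N" "N \<subseteq> U" "proj_diffeo N M F"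
    using assms(4) \<open>Z \<in> U\<close> unfolding proj_local_diffeo_def by blast
  have "Z \<in> proj_space" using assms(3) \<open>Z \<in> U\<close> unfolding openin_proj_topology by blast
  then have "subspace Z" "dim Z = 1" unfolding proj_space_def by auto
  have "\<not> Z \<subseteq> {0}" using \<open>dim Z = 1\<close> dim_eq_0[of Z] by simp
  then obtain z where z: "z \<in> Z" "z \<noteq> 0" by blast
  have "span {z} = span Z"
    by (rule dim_eq_span) (use z \<open>dim Z = 1\<close> in auto)
  then have Zz: "Z = span {z}" using \<open>subspace Z\<close> by (metis span_eq_iff)
  have "proj_smooth_on N F" using NM unfolding proj_diffeo_def by blast
  then obtain W1 f where W1: "z \<in> W1" "is_lift F W1 f"
    using NM z Zz unfolding proj_smooth_on_def by blast
  \<comment> \<open>Shrinking the domain of the lift puts every line through a point of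
    \<open>W\<close> into \<open>N\<close>, hence into \<open>U\<close>, where the correspondence
    holds.\<close>
  define W where "W = W1 \<inter> {v. v \<noteq> 0 \<and> span {v} \<in> N}"
  have "open {v. v \<noteq> 0 \<and> span {v} \<in> N}"
    using NM unfolding proj_diffeo_def openin_proj_topology by blast
  moreover have "open W1" using W1 unfolding is_lift_def by blast
  ultimately have "open W" unfolding W_def by blast
  with W1(2) have L: "is_lift F W f" by (rule is_lift_subset) (simp add: W_def)
  have zW: "z \<in> W" unfolding W_def using W1 z Zz NM by blast
  have fz0: "f z \<noteq> 0" and Fz: "F Z = span {f z}" using L zW Zz unfolding is_lift_def by auto
  let ?D = "frechet_derivative f (at z)"
  have "linear ?D" using is_lift_has_derivative[OF L zW] has_derivative_linear by blast
  have same: "0 \<le> \<omega> z v * \<omega> (f z) (?D v)" for v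
  proof (rule billiard_lift_forms_same_sign[OF assms(1,2) L zW])
    fix w assume "w \<in> W"
    then have "span {w} \<in> U" using NM unfolding W_def by blast
    then show "outer_contact_billiard \<omega> S (span {w}) (F (span {w}))" using assms(5) by blast
  qed
  have surj: "\<exists>v d. u = ?D v + d *\<^sub>R f z" for u
    using lift_derivative_surj_mod_line[OF NM(3) L zW] NM(1) Zz by metis
  have alt: "\<omega> (f z) (f z) = 0" using assms(1) unfolding symplectic_form_def by blast
  have eval: "\<omega> (f z) (?D v + d *\<^sub>R f z) = \<omega> (f z) (?D v)" for v d
    using alt by (simp add: bilinear_radd[OF om] bilinear_rmul[OF om])
  have lin1: "linear (\<omega> z)" by (rule linr)
  have lin2: "linear (\<lambda>v. \<omega> (f z) (?D v))"
    using linear_compose[OF \<open>linear ?D\<close> linr] by (simp add: o_def)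
  obtain v1 where v1: "\<omega> z v1 \<noteq> 0" using nondeg z(2) by blast
  \<comment> \<open>The pulled-back form is nonzero because the range of \<open>?D\<close> is
    everything modulo \<open>f z\<close>, on which \<open>\<omega> (f z)\<close> vanishes.\<close>
  obtain u2 where "\<omega> (f z) u2 \<noteq> 0" using nondeg fz0 by blast
  then obtain v2 where v2: "\<omega> (f z) (?D v2) \<noteq> 0" using surj[of u2] eval by metis
  \<comment> \<open>The sign condition is symmetric in the two nonzero forms, so the kernel lemma
    gives both inclusions.\<close>
  have kernel: "\<omega> z v = 0 \<longleftrightarrow> \<omega> (f z) (?D v) = 0" for v
  proof
    assume "\<omega> z v = 0"
    then show "\<omega> (f z) (?D v) = 0"
      by (rule kernel_subset_of_same_sign[where \<beta> = "\<lambda>v. \<omega> (f z) (?D v)", OF lin1 lin2 same v1])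
  next
    assume "\<omega> (f z) (?D v) = 0"
    moreover have "0 \<le> \<omega> (f z) (?D v) * \<omega> z v" for v using same[of v] by (simp add: mult.commute)
    ultimately show "\<omega> z v = 0"
      using kernel_subset_of_same_sign[where \<alpha> = "\<lambda>v. \<omega> (f z) (?D v)", OF lin2 lin1 _ v2] by blast
  qed
  have swap: "\<omega> u v = 0 \<longleftrightarrow> \<omega> v u = 0" for u v using skew[of u v] by simp
  have deriv: "proj_deriv F Z (tangent_vec z v) = tangent_vec (f z) (?D v)" for v
    by (rule proj_deriv_eq[OF L zW]) (use z in auto)
  have src: "contact_plane \<omega> Z = {tangent_vec z v | v. \<omega> z v = 0}"
    unfolding Zz contact_plane_span[OF om z(2)] using swap by blast
  have tgt: "contact_plane \<omega> (F Z) = {tangent_vec (f z) u | u. \<omega> (f z) u = 0}"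
    unfolding Fz contact_plane_span[OF om fz0] using swap by blast
  show "proj_deriv F Z ` contact_plane \<omega> Z = contact_plane \<omega> (F Z)"
  proof (intro equalityI subsetI)
    fix Y assume "Y \<in> proj_deriv F Z ` contact_plane \<omega> Z"
    then obtain v where "\<omega> z v = 0" "Y = proj_deriv F Z (tangent_vec z v)" unfolding src by blast
    then show "Y \<in> contact_plane \<omega> (F Z)" unfolding tgt using kernel deriv by blast
  next
    fix Y assume "Y \<in> contact_plane \<omega> (F Z)"
    then obtain u where u: "\<omega> (f z) u = 0" "Y = tangent_vec (f z) u" unfolding tgt by blast
    \<comment> \<open>The multiple of \<open>f z\<close> changes neither the value of
      \<open>\<omega> (f z)\<close> nor the tangent vector, so \<open>v\<close> represents a
      preimage.\<close>
    obtain v d where v: "u = ?D v + d *\<^sub>R f z" using surj by blast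
    have "\<omega> z v = 0" using u(1) kernel eval unfolding v by metis
    moreover have "Y = tangent_vec (f z) (?D v)"
      unfolding u(2) v by (rule tangent_vec_eqI[of 1 _ _ _ _ d]) auto
    ultimately show "Y \<in> proj_deriv F Z ` contact_plane \<omega> Z"
      unfolding src using deriv by (metis (mono_tags, lifting) image_eqI mem_Collect_eq)
  qed
qed

end
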